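(* Let $n \ge 3$, let $G=K_n$ be the complete graph of order $n$, and let $f: V(G_1)\to V(G_2)$ be a function with $|f(V(G_1))| = s$, where $1 < s < n$. Then $\dim(C(K_n, f)) = 2n-2-s$.
   Context: For a connected graph $H$, a set $S \subseteq V(H)$ is a resolving set if for every two distinct vertices $x,y$ of $H$ there is $s \in S$ with $d_H(x,s) \neq d_H(y,s)$; the metric dimension $\dim(H)$ is the minimum cardinality of a resolving set of $H$. Given a graph $G$, let $G_1$ and $G_2$ be disjoint copies of $G$ and let $f: V(G_1)\to V(G_2)$ be a function. The functigraph $C(G,f)$ is the graph with vertex set $V(G_1)\cup V(G_2)$ and edge set $E(G_1)\cup E(G_2)\cup\{uv \mid u \in V(G_1),\ v=f(u)\}$. *)

theory Defs
  imports "Graph_Theory.Graph_Theory" "HOL-Library.FuncSet"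
begin

text \<open>As in Graph_Theory, undirected graphs are symmetric digraphs: an edge is a pair of
  opposite arcs.\<close>

definition graph_dist :: "('a, 'b) pre_digraph \<Rightarrow> 'a \<Rightarrow> 'a \<Rightarrow> ereal" where
  "graph_dist H u v = wf_digraph.\<mu> H (\<lambda>_. 1) u v"

definition resolving_set :: "('a, 'b) pre_digraph \<Rightarrow> 'a set \<Rightarrow> bool" where
  "resolving_set H S \<longleftrightarrow> S \<subseteq> verts H \<and>
     (\<forall>x\<in>verts H. \<forall>y\<in>verts H. x \<noteq> y \<longrightarrow> (\<exists>s\<in>S. graph_dist H x s \<noteq> graph_dist H y s))"

text \<open>Only meant for connected finite graphs. There the full vertex set is resolving, so the
  minimum exists.\<close>

definition metric_dim :: "('a, 'b) pre_digraph \<Rightarrow> nat" where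
  "metric_dim H = (LEAST k. \<exists>S. finite S \<and> resolving_set H S \<and> card S = k)"

text \<open>The copies of the graph are tagged with \<open>Inl\<close> (the domain copy) and \<open>Inr\<close>
  (the codomain copy); \<open>f\<close> is given on the untagged vertices.\<close>

definition functigraph :: "'a pair_pre_digraph \<Rightarrow> ('a \<Rightarrow> 'a) \<Rightarrow> ('a + 'a) pair_pre_digraph" where
  "functigraph G f = \<lparr>
     pverts = Inl ` pverts G \<union> Inr ` pverts G,
     parcs = {(Inl u, Inl v) | u v. (u, v) \<in> parcs G}
           \<union> {(Inr u, Inr v) | u v. (u, v) \<in> parcs G}
           \<union> {(Inl u, Inr (f u)) | u. u \<in> pverts G}
           \<union> {(Inr (f u), Inl u) | u. u \<in> pverts G} \<rparr>"

lemma pair_graph_functigraph: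
  assumes "pair_graph G" "f \<in> pverts G \<rightarrow> pverts G"
  shows "pair_graph (functigraph G f)"
proof -
  interpret pair_graph G by fact
  let ?F = "functigraph G f"
  have wf: "e \<in> parcs ?F \<Longrightarrow> fst e \<in> pverts ?F \<and> snd e \<in> pverts ?F" for e
    using assms(2) in_arcsD1 in_arcsD2 by (auto simp: functigraph_def)
  have fin: "finite (pverts ?F)"
    by (simp add: functigraph_def pair_finite_verts)
  have "parcs ?F \<subseteq> pverts ?F \<times> pverts ?F"
    using wf by (auto simp: mem_Times_iff)
  then have fin': "finite (parcs ?F)"
    using fin finite_subset by blast
  have "sym (parcs G)"
    using pair_sym_arcs by (simp add: symmetric_def)
  then have "sym (parcs ?F)"
    unfolding functigraph_def sym_def by auto
  then have sy: "symmetric ?F" by (simp add: symmetric_def)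
  have "e \<in> parcs ?F \<Longrightarrow> fst e \<noteq> snd e" for e
    using pair_no_loops by (fastforce simp: functigraph_def)
  then show ?thesis
    using wf fin fin' sy by unfold_locales auto
qed

lemma connected_functigraph:
  assumes G: "pair_graph G" "f \<in> pverts G \<rightarrow> pverts G" and c: "connected (with_proj G)"
  shows "connected (with_proj (functigraph G f))"
proof -
  interpret G: pair_graph G by fact
  let ?F = "functigraph G f"
  interpret F: pair_graph ?F by (rule pair_graph_functigraph) fact+
  have sG: "u \<rightarrow>\<^sup>*\<^bsub>with_proj G\<^esub> v" if "u \<in> pverts G" "v \<in> pverts G" for u v
    using G.symmetric_connected_imp_strongly_connected[OF G.sym_arcs c] that
    by (auto simp: strongly_connected_def)
  have arcF: "(a, b) \<in> parcs ?F \<Longrightarrow> a \<rightarrow>\<^sup>*\<^bsub>with_proj ?F\<^esub> b" for a b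
    using F.reachable_adjI by simp
  have lift: "Inl u \<rightarrow>\<^sup>*\<^bsub>with_proj ?F\<^esub> Inl v \<and> Inr u \<rightarrow>\<^sup>*\<^bsub>with_proj ?F\<^esub> Inr v"
    if "u \<rightarrow>\<^sup>*\<^bsub>with_proj G\<^esub> v" for u v
    using that
  proof (induct rule: G.reachable_induct)
    case base
    then have "Inl u \<in> pverts ?F" "Inr u \<in> pverts ?F" by (auto simp: functigraph_def)
    then show ?case by (simp add: F.reachable_refl)
  next
    case (step x y)
    have "(Inl x, Inl y) \<in> parcs ?F" "(Inr x, Inr y) \<in> parcs ?F"
      using step by (auto simp: functigraph_def)
    then show ?case
      using step arcF F.reachable_trans by blast
  qed
  have lr: "Inl u \<rightarrow>\<^sup>*\<^bsub>with_proj ?F\<^esub> Inr v" if "u \<in> pverts G" "v \<in> pverts G" for u v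
  proof -
    have "Inl u \<rightarrow>\<^sup>*\<^bsub>with_proj ?F\<^esub> Inr (f u)"
      using that by (intro arcF) (auto simp: functigraph_def)
    moreover have "Inr (f u) \<rightarrow>\<^sup>*\<^bsub>with_proj ?F\<^esub> Inr v"
      using that G by (intro lift[THEN conjunct2] sG) auto
    ultimately show ?thesis using F.reachable_trans by blast
  qed
  have ne: "verts (with_proj G) \<noteq> {}"
    using c by (auto simp: connected_def strongly_connected_def)
  have "strongly_connected (with_proj ?F)"
  proof (rule strongly_connectedI)
    show "verts (with_proj ?F) \<noteq> {}" using ne by (simp add: functigraph_def)
  next
    fix a b assume "a \<in> verts (with_proj ?F)" "b \<in> verts (with_proj ?F)"
    then show "a \<rightarrow>\<^sup>*\<^bsub>with_proj ?F\<^esub> b"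
      using lift sG lr symmetric_reachable[OF F.sym_arcs] by (auto simp: functigraph_def)
  qed
  then show ?thesis
    unfolding connected_conv strongly_connected_def reachable_def
    by (auto intro: rtrancl_on_mono[rotated 2] simp: symcl_def)
qed

end

theory Submission
  imports Defs
begin

text \<open>All distances in the functigraph of a complete graph are at most 2, so a landmark only tells
  apart equality, adjacency and non-adjacency. A resolving set therefore omits at most one vertex of
  each fibre of \<open>f\<close> and at most one vertex of the codomain copy outside the image, and of two fibres
  with an omitted vertex, one must have its image point in the set. Counting gives
  the lower bound \<open>(n - 1) + (n - s - 1)\<close>. It is attained by all vertices of the domain copy but one
  lying in a fibre with at least two elements, together with all non-image vertices but one.\<close>

section \<open>Distances 0, 1 and 2 in a finite loop-free symmetric digraph\<close>

lemma
  assumes "pair_graph H"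
  shows graph_dist_self: "x \<in> pverts H \<Longrightarrow> graph_dist H x x = 0"
    and graph_dist_adjacent: "(x, y) \<in> parcs H \<Longrightarrow> graph_dist H x y = 1"
    and graph_dist_two: "(x, z) \<in> parcs H \<Longrightarrow> (z, y) \<in> parcs H \<Longrightarrow> x \<noteq> y \<Longrightarrow> (x, y) \<notin> parcs H \<Longrightarrow>
           graph_dist H x y = 2"
proof -
  interpret pair_graph H by fact
  have cost: "awalk_cost (\<lambda>_. 1) p = real (length p)" for p :: "('a \<times> 'a) list"
    by (induction p) auto
  have dist: "graph_dist H u v = (INF p\<in>{p. awalk u p v}. ereal (real (length p)))" for u v
    by (simp add: graph_dist_def \<mu>_def cost)
  \<comment> \<open>With unit costs the distance is an infimum of walk lengths, so one walk of
    length \<open>k\<close> and a proof that none is shorter determine it.\<close>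
  have eqI: "graph_dist H u v = ereal (real k)"
    if "awalk u q v" "length q = k" "\<And>p. awalk u p v \<Longrightarrow> k \<le> length p" for u v q k
    unfolding dist
  proof (rule antisym)
    show "(INF p\<in>{p. awalk u p v}. ereal (real (length p))) \<le> ereal (real k)"
      using that(1,2) by (auto intro: INF_lower2)
    show "ereal (real k) \<le> (INF p\<in>{p. awalk u p v}. ereal (real (length p)))"
      using that(3) by (auto intro: INF_greatest)
  qed
  have no_loop: "u \<noteq> v" if "(u, v) \<in> parcs H" for u v
    using no_loops[OF that] by simp
  show "graph_dist H x x = 0" if "x \<in> pverts H"
    using eqI[of x "[]" x 0] that by (simp add: awalk_Nil_iff zero_ereal_def)
  show "graph_dist H x y = 1" if "(x, y) \<in> parcs H"
  proof -
    have "1 \<le> length p" if "awalk x p y" for p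
      using that no_loop[OF \<open>(x, y) \<in> parcs H\<close>] by (cases p) (auto simp: awalk_Nil_iff)
    then show ?thesis
      using eqI[of x "[(x, y)]" y 1] that
      by (simp add: awalk_simps in_arcsD2 one_ereal_def)
  qed
  show "graph_dist H x y = 2"
    if "(x, z) \<in> parcs H" "(z, y) \<in> parcs H" "x \<noteq> y" "(x, y) \<notin> parcs H"
  proof -
    have "2 \<le> length p" if "awalk x p y" for p
    proof (rule ccontr)
      assume "\<not> 2 \<le> length p"
      then consider "p = []" | e where "p = [e]"
        by (cases p; cases "tl p") auto
      then show False
        using that \<open>x \<noteq> y\<close> \<open>(x, y) \<notin> parcs H\<close> by cases (auto simp: awalk_simps)
    qed
    then show ?thesis
      using eqI[of x "[(x, z), (z, y)]" y 2] that
      by (simp add: awalk_simps in_arcsD2)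
  qed
qed

section \<open>Resolving sets of the functigraph of a complete graph\<close>

locale complete_functigraph =
  fixes V :: "'a set" and G :: "'a pair_pre_digraph" and f :: "'a \<Rightarrow> 'a"
  assumes graph: "pair_graph G"
    and verts: "pverts G = V"
    and arcs: "parcs G = {(u, v). u \<in> V \<and> v \<in> V \<and> u \<noteq> v}"
    and maps: "f \<in> V \<rightarrow> V"
begin

lemma finite_V: "finite V"
proof -
  interpret pair_graph G by (rule graph)
  show ?thesis using pair_finite_verts verts by simp
qed

lemma f_in: "u \<in> V \<Longrightarrow> f u \<in> V"
  using maps by auto

lemma pverts_functigraph: "pverts (functigraph G f) = Inl ` V \<union> Inr ` V"
  by (simp add: functigraph_def verts)

lemma parcs_functigraph:
  "(Inl u, Inl v) \<in> parcs (functigraph G f) \<longleftrightarrow> u \<in> V \<and> v \<in> V \<and> u \<noteq> v"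
  "(Inr u, Inr v) \<in> parcs (functigraph G f) \<longleftrightarrow> u \<in> V \<and> v \<in> V \<and> u \<noteq> v"
  "(Inl u, Inr v) \<in> parcs (functigraph G f) \<longleftrightarrow> u \<in> V \<and> v = f u"
  "(Inr v, Inl u) \<in> parcs (functigraph G f) \<longleftrightarrow> u \<in> V \<and> v = f u"
  by (auto simp: functigraph_def arcs verts)

lemma dist_functigraph:
  assumes "u \<in> V" "v \<in> V"
  shows "graph_dist (functigraph G f) (Inl u) (Inl v) = (if u = v then 0 else 1)"
    and "graph_dist (functigraph G f) (Inr u) (Inr v) = (if u = v then 0 else 1)"
    and "graph_dist (functigraph G f) (Inl u) (Inr v) = (if f u = v then 1 else 2)"
    and "graph_dist (functigraph G f) (Inr v) (Inl u) = (if f u = v then 1 else 2)"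
proof -
  have F: "pair_graph (functigraph G f)"
    by (rule pair_graph_functigraph[OF graph]) (use maps verts in simp)
  \<comment> \<open>The only non-adjacent pairs are \<open>Inl u\<close>, \<open>Inr v\<close> with
    \<open>f u\<close> distinct from \<open>v\<close>; \<open>Inr (f u)\<close> is adjacent to
    both.\<close>
  note dist = graph_dist_self[OF F] graph_dist_adjacent[OF F]
    graph_dist_two[OF F, where z = "Inr (f u)"]
  show "graph_dist (functigraph G f) (Inl u) (Inl v) = (if u = v then 0 else 1)"
    and "graph_dist (functigraph G f) (Inr u) (Inr v) = (if u = v then 0 else 1)"
    and "graph_dist (functigraph G f) (Inl u) (Inr v) = (if f u = v then 1 else 2)"
    and "graph_dist (functigraph G f) (Inr v) (Inl u) = (if f u = v then 1 else 2)"
    using assms f_in by (auto simp: dist parcs_functigraph pverts_functigraph)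
qed

text \<open>Landmarks in the image are counted against the omitted domain vertices, landmarks off
  the image against the non-image vertices. The additive form avoids truncated subtraction.\<close>

lemma resolving_set_lower_bound:
  assumes "resolving_set (functigraph G f) S"
  shows "2 * card V \<le> card S + card (f ` V) + 2"
proof -
  define A B where "A = Inl -` S" and "B = Inr -` S"
  have SV: "S \<subseteq> Inl ` V \<union> Inr ` V"
    using assms by (simp add: resolving_set_def pverts_functigraph)
  have S: "S = Inl ` A \<union> Inr ` B"
  proof (intro set_eqI)
    show "x \<in> S \<longleftrightarrow> x \<in> Inl ` A \<union> Inr ` B" for x
      by (cases x) (auto simp: A_def B_def)
  qed
  have AB: "A \<subseteq> V" "B \<subseteq> V"
    using SV by (auto simp: A_def B_def)
  have fin: "finite A" "finite B"
    using AB finite_V by (auto intro: finite_subset)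
  have card_S: "card S = card A + card B"
    unfolding S using fin by (subst card_Un_disjoint) (auto simp: card_image)
  have resolve: "\<exists>t\<in>S. graph_dist (functigraph G f) x t \<noteq> graph_dist (functigraph G f) y t"
    if "x \<in> Inl ` V \<union> Inr ` V" "y \<in> Inl ` V \<union> Inr ` V" "x \<noteq> y" for x y
    using assms that by (simp add: resolving_set_def pverts_functigraph)
  \<comment> \<open>Every landmark in the domain copy is at distance 1 from both omitted vertices.
    Only \<open>Inr b\<close> with \<open>b\<close> equal to exactly one of \<open>f a\<close>,
    \<open>f a'\<close> can separate them.\<close>
  have A_fibre: "f a \<noteq> f a' \<and> (f a \<in> B \<or> f a' \<in> B)"
    if a: "a \<in> V - A" "a' \<in> V - A" "a \<noteq> a'" for a a'
  proof -
    obtain t where t: "t \<in> S"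
      "graph_dist (functigraph G f) (Inl a) t \<noteq> graph_dist (functigraph G f) (Inl a') t"
      using resolve[of "Inl a" "Inl a'"] a by auto
    show ?thesis
    proof (cases t)
      case (Inl c)
      then have "c \<in> A" "c \<in> V" using t AB by (auto simp: A_def)
      then show ?thesis using t a Inl by (auto simp: dist_functigraph split: if_splits)
    next
      case (Inr b)
      then have "b \<in> B" "b \<in> V" using t AB by (auto simp: B_def)
      then show ?thesis using t a Inr by (auto simp: dist_functigraph split: if_splits)
    qed
  qed
  \<comment> \<open>Domain landmarks are at distance 2 from both non-image vertices, codomain
    landmarks at distance 1, so nothing separates two omitted ones.\<close>
  have outside: "b = b'" if b: "b \<in> V - f ` V - B" "b' \<in> V - f ` V - B" for b b'
  proof (rule ccontr)
    assume "b \<noteq> b'"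
    then obtain t where t: "t \<in> S"
      "graph_dist (functigraph G f) (Inr b) t \<noteq> graph_dist (functigraph G f) (Inr b') t"
      using resolve[of "Inr b" "Inr b'"] b by auto
    show False
    proof (cases t)
      case (Inl c)
      then have "c \<in> V" using t AB by (auto simp: A_def)
      then show ?thesis using t b Inl by (auto simp: dist_functigraph split: if_splits)
    next
      case (Inr c)
      then have "c \<in> B" "c \<in> V" using t AB by (auto simp: B_def)
      then show ?thesis using t b Inr by (auto simp: dist_functigraph split: if_splits)
    qed
  qed
  let ?I = "f ` V"
  have "card V - card A = card (V - A)"
    using AB fin by (simp add: card_Diff_subset)
  also have "\<dots> = card (f ` (V - A))"
    using A_fibre by (intro card_image[symmetric] inj_onI) blast
  also have "\<dots> \<le> card ((B \<inter> ?I) \<union> (f ` (V - A) - B))"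
    using fin finite_V by (intro card_mono) auto
  also have "\<dots> \<le> card (B \<inter> ?I) + card (f ` (V - A) - B)"
    by (rule card_Un_le)
  \<comment> \<open>Two different points here would be images of two omitted vertices with neither
    image in \<open>B\<close>, against \<open>A_fibre\<close>.\<close>
  also have "card (f ` (V - A) - B) \<le> 1"
    using A_fibre finite_V by (intro card_le_Suc0_iff_eq[THEN iffD2, unfolded One_nat_def[symmetric]]) blast+
  finally have 1: "card V \<le> card A + card (B \<inter> ?I) + 1"
    by simp
  have "card V - card ?I = card (V - ?I)"
    using finite_V f_in by (subst card_Diff_subset) auto
  also have "\<dots> \<le> card ((B - ?I) \<union> (V - ?I - B))"
    using fin finite_V by (intro card_mono) auto
  also have "\<dots> \<le> card (B - ?I) + card (V - ?I - B)"
    by (rule card_Un_le)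
  also have "card (V - ?I - B) \<le> 1"
    using outside finite_V by (intro card_le_Suc0_iff_eq[THEN iffD2, unfolded One_nat_def[symmetric]]) blast+
  finally have 2: "card V \<le> card ?I + card (B - ?I) + 1"
    by simp
  have "card B = card (B \<inter> ?I) + card (B - ?I)"
    using fin by (metis card_Int_Diff)
  with 1 2 card_S show ?thesis by simp
qed

lemma resolving_set_witness:
  assumes "1 < card (f ` V)" "card (f ` V) < card V"
  obtains S where "finite S" "resolving_set (functigraph G f) S"
    "card S + card (f ` V) + 2 = 2 * card V"
proof -
  \<comment> \<open>The strict bound on the image forces a collision: \<open>a\<^sub>0\<close> will
    be omitted, while \<open>a\<^sub>1\<close> keeps its fibre represented.\<close>
  have "\<not> inj_on f V"
    using assms by (auto simp: card_image)
  then obtain a\<^sub>0 a\<^sub>1 where a: "a\<^sub>0 \<in> V" "a\<^sub>1 \<in> V" "a\<^sub>0 \<noteq> a\<^sub>1" "f a\<^sub>0 = f a\<^sub>1"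
    by (auto simp: inj_on_def)
  have other: "\<exists>c\<in>V. f c \<noteq> b" for b
  proof (rule ccontr)
    assume "\<not> ?thesis"
    then have "f ` V \<subseteq> {b}" by auto
    then have "card (f ` V) \<le> card {b}" by (intro card_mono) auto
    with assms show False by simp
  qed
  have sub: "f ` V \<subseteq> V" using f_in by auto
  have cI: "card (V - f ` V) = card V - card (f ` V)"
    using finite_V sub by (simp add: card_Diff_subset)
  then obtain b\<^sub>0 where b: "b\<^sub>0 \<in> V" "b\<^sub>0 \<notin> f ` V"
    using assms by (metis Diff_iff card.empty ex_in_conv not_less_iff_gr_or_eq zero_less_diff)
  \<comment> \<open>Image vertices of the codomain copy can all be left out, since a preimage other
    than \<open>a\<^sub>0\<close> detects each of them.\<close>
  define S where "S = Inl ` (V - {a\<^sub>0}) \<union> Inr ` (V - f ` V - {b\<^sub>0})"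
  have "card S = card (V - {a\<^sub>0}) + card (V - f ` V - {b\<^sub>0})"
    unfolding S_def using finite_V by (subst card_Un_disjoint) (auto simp: card_image)
  also have "\<dots> = (card V - 1) + (card V - card (f ` V) - 1)"
    using a b finite_V cI by simp
  finally have card_S: "card S + card (f ` V) + 2 = 2 * card V"
    using assms by simp
  have fibre: "\<exists>c\<in>V - {a\<^sub>0}. f c = v" if "v \<in> f ` V" for v
    using that a by (metis Diff_iff image_iff singletonD)
  have sep: "\<exists>t\<in>S. graph_dist (functigraph G f) x t \<noteq> graph_dist (functigraph G f) y t"
    if "(\<exists>c\<in>V - {a\<^sub>0}. graph_dist (functigraph G f) x (Inl c) \<noteq> graph_dist (functigraph G f) y (Inl c)) \<or>
      (\<exists>c\<in>V - f ` V - {b\<^sub>0}. graph_dist (functigraph G f) x (Inr c) \<noteq> graph_dist (functigraph G f) y (Inr c))"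
    for x y
    using that unfolding S_def by blast
  have ll: "\<exists>t\<in>S. graph_dist (functigraph G f) (Inl x) t \<noteq> graph_dist (functigraph G f) (Inl y) t"
    if "x \<in> V" "y \<in> V" "x \<noteq> y" for x y
  proof -
    \<comment> \<open>Whichever vertex is not \<open>a\<^sub>0\<close> serves as its own landmark,
      at distance 0.\<close>
    have "x \<in> V - {a\<^sub>0} \<or> y \<in> V - {a\<^sub>0}" using that by auto
    then show ?thesis
      using that by (intro sep disjI1) (auto simp: dist_functigraph intro: bexI[of _ x] bexI[of _ y])
  qed
  have lr: "\<exists>t\<in>S. graph_dist (functigraph G f) (Inl x) t \<noteq> graph_dist (functigraph G f) (Inr y) t"
    if "x \<in> V" "y \<in> V" for x y
  proof (cases "x = a\<^sub>0")
    case True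
    \<comment> \<open>\<open>Inl c\<close> is at distance 1 from \<open>Inl a\<^sub>0\<close> and 2
      from \<open>Inr y\<close>. If \<open>other\<close> yields \<open>a\<^sub>0\<close> itself,
      \<open>a\<^sub>1\<close> has the same image and replaces it.\<close>
    obtain c where c: "c \<in> V" "f c \<noteq> y" "c \<noteq> a\<^sub>0"
      using other[of y] a by metis
    then show ?thesis
      using that True by (intro sep disjI1 bexI[of _ c]) (auto simp: dist_functigraph)
  next
    case False
    then show ?thesis
      using that by (intro sep disjI1 bexI[of _ x]) (auto simp: dist_functigraph)
  qed
  \<comment> \<open>The asymmetric condition on \<open>b\<^sub>0\<close> makes \<open>x\<close>
    detectable: by a preimage in \<open>S\<close> if it is an image point, by itself otherwise. Of
    two distinct vertices at least one satisfies it, so both orders are tried later.\<close>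
  have rr: "\<exists>t\<in>S. graph_dist (functigraph G f) (Inr x) t \<noteq> graph_dist (functigraph G f) (Inr y) t"
    if "x \<in> V" "y \<in> V" "x \<noteq> y" "x \<noteq> b\<^sub>0" for x y
  proof (cases "x \<in> f ` V")
    case True
    then obtain c where "c \<in> V - {a\<^sub>0}" "f c = x" using fibre by blast
    then show ?thesis
      using that by (intro sep disjI1 bexI[of _ c]) (auto simp: dist_functigraph)
  next
    case False
    then show ?thesis
      using that by (intro sep disjI2 bexI[of _ x]) (auto simp: dist_functigraph)
  qed
  have "resolving_set (functigraph G f) S"
    unfolding resolving_set_def with_proj_simps pverts_functigraph
  proof (intro conjI ballI impI)
    show "S \<subseteq> Inl ` V \<union> Inr ` V" by (auto simp: S_def)
    fix x y :: "'a + 'a"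
    assume xy: "x \<in> Inl ` V \<union> Inr ` V" "y \<in> Inl ` V \<union> Inr ` V" "x \<noteq> y"
    show "\<exists>t\<in>S. graph_dist (functigraph G f) x t \<noteq> graph_dist (functigraph G f) y t"
    proof (cases x; cases y)
      fix u v assume "x = Inl u" "y = Inl v"
      then show ?thesis using xy ll[of u v] by auto
    next
      fix u v assume "x = Inl u" "y = Inr v"
      then show ?thesis using xy lr[of u v] by auto
    next
      fix u v assume "x = Inr u" "y = Inl v"
      then show ?thesis using xy lr[of v u] by (metis Inl_Inr_False Inr_Inl_False Un_iff imageE sum.inject)
    next
      fix u v assume e: "x = Inr u" "y = Inr v"
      then have "u \<in> V" "v \<in> V" "u \<noteq> v" using xy by auto
      then show ?thesis unfolding e using rr[of u v] rr[of v u] by metis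
    qed
  qed
  moreover have "finite S" using finite_V by (simp add: S_def)
  ultimately show thesis using card_S that by blast
qed

end

theorem theorem3p6:
  fixes G :: "'a pair_pre_digraph" and f :: "'a \<Rightarrow> 'a" and n s :: nat
  assumes "n \<ge> 3"
    and "complete_digraph n G"
    and "f \<in> pverts G \<rightarrow> pverts G"
    and "card (f ` pverts G) = s"
    and "1 < s" and "s < n"
  shows "int (metric_dim (functigraph G f)) = 2 * int n - 2 - int s"
proof -
  have K: "card (pverts G) = n" "parcs G = {(u, v). u \<in> pverts G \<and> v \<in> pverts G \<and> u \<noteq> v}"
    using assms(2) by (auto simp: complete_digraph_pair_def)
  have "pair_graph G"
    using assms(2) by (rule pair_graphI_complete)
  then interpret complete_functigraph "pverts G" G f
    using K assms(3) by (intro complete_functigraph.intro) auto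
  obtain S where S: "finite S" "resolving_set (functigraph G f) S" "card S + s + 2 = 2 * n"
    using resolving_set_witness assms K by metis
  have "metric_dim (functigraph G f) = card S"
    unfolding metric_dim_def
  proof (rule Least_equality)
    show "\<exists>T. finite T \<and> resolving_set (functigraph G f) T \<and> card T = card S"
      using S by blast
    \<comment> \<open>The lower bound for a competing set and the exact count for \<open>S\<close>
      share the summand \<open>s + 2\<close>, which cancels.\<close>
    show "card S \<le> k" if "\<exists>T. finite T \<and> resolving_set (functigraph G f) T \<and> card T = k" for k
      using that resolving_set_lower_bound S(3) assms(4) K(1) by fastforce
  qed
  with S(3) show ?thesis by linarith
qed

end
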